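(* For every $\varepsilon>0$ there exists $r\in(2-\varepsilon,2)$ for which the set $\mathbf S_r=\{\lfloor r^n\rfloor : n\in\mathbb N\}$ is not tail Sidon.
   Context: $\mathbb N$ denotes the positive integers. A set $A\subset\mathbb N$ is called a Sidon set if the equation $a+b=c+d$ has no non-trivial solutions in $A$, i.e. whenever $a,b,c,d\in A$ satisfy $a+b=c+d$, one has $\{a,b\}=\{c,d\}$. For real $r>1$, put $\mathbf S_r:=\{\lfloor r^n\rfloor : n\in\mathbb N\}$; the values of $r$ of interest are those in $(1,2)$. The set $\mathbf S_r$ is called tail Sidon if there exists $N_0$ such that the set $\{\lfloor r^n\rfloor : n\ge N_0\}$ is a Sidon set. *)

theory Defs
  imports Complex_Main
begin

definition sidon :: "nat set \<Rightarrow> bool" where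
  "sidon A \<longleftrightarrow>
     (\<forall>a\<in>A. \<forall>b\<in>A. \<forall>c\<in>A. \<forall>d\<in>A. a + b = c + d \<longrightarrow> {a, b} = {c, d})"

(* Exponents range over the positive integers, so S_tail r 1 is the whole set S_r.
   Intended for r > 1; then every floor is positive and nat loses nothing. *)
definition S_tail :: "real \<Rightarrow> nat \<Rightarrow> nat set" where
  "S_tail r N0 = {nat \<lfloor>r ^ n\<rfloor> | n. 1 \<le> n \<and> N0 \<le> n}"

(* Phrased in terms of r, because tails are taken with respect to the exponent n. *)
definition tail_sidon :: "real \<Rightarrow> bool" where
  "tail_sidon r \<longleftrightarrow> (\<exists>N0. sidon (S_tail r N0))"

end

theory Submission
  imports Defs
begin

text \<open>
  Let \<open>k\<close> be odd and let \<open>r\<close> be the root of \<open>(2 - r) r\<^sup>k = 1\<close> near \<open>2\<close>, so that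
  \<open>r\<^sup>n\<^sup>+\<^sup>k\<^sup>+\<^sup>1 + r\<^sup>n = 2 r\<^sup>n\<^sup>+\<^sup>k\<close>. The number \<open>r\<close> is Pisot, and its traces \<open>T\<^sub>n\<close> are integers with
  error \<open>e\<^sub>n = T\<^sub>n - r\<^sup>n\<close> tending to \<open>0\<close>. Whenever \<open>e\<^sub>n\<close>, \<open>e\<^sub>n\<^sub>+\<^sub>k\<close>, \<open>e\<^sub>n\<^sub>+\<^sub>k\<^sub>+\<^sub>1\<close> have the same sign, the
  floors satisfy the same relation as the powers, which violates the Sidon property. If this
  happened only finitely often, the recurrence for \<open>e\<close> would force the sign of \<open>e\<close> to flip
  under the shift by \<open>k + 1\<close>. Let \<open>U\<close> be the negative of this shift and let \<open>a \<ge> 0\<close> be the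
  absolute value of \<open>e\<close> along a progression with difference \<open>k + 1\<close>. As \<open>2 S\<^sup>k = 1 - U\<close> for the
  shift \<open>S\<close>, and \<open>k\<close> is odd, \<open>(1 - U)\<^sup>k\<^sup>+\<^sup>1 a = - 2\<^sup>k\<^sup>+\<^sup>1 U\<^sup>k a \<le> 0\<close>. A null sequence \<open>x\<close> with
  \<open>(1 - U) x \<le> 0\<close> is increasing, hence \<open>x \<le> 0\<close>; applied \<open>k + 1\<close> times this gives \<open>a \<le> 0\<close>, so
  \<open>a = 0\<close>, contradicting the flipping sign.
\<close>

section \<open>Real sequences: averages, contractions and iterated differences\<close>

text \<open>A nonpositive term keeps its share of at least \<open>\<delta>\<close> out of the upper
  bound; a nonnegative term does the same for the lower bound.\<close>

lemma abs_weighted_sum_le: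
  fixes w x :: "nat \<Rightarrow> real"
  assumes w: "\<And>i. i < k \<Longrightarrow> \<delta> \<le> w i" and "0 < \<delta>" and w1: "(\<Sum>i<k. w i) = 1"
    and x: "\<And>i. i < k \<Longrightarrow> \<bar>x i\<bar> \<le> M"
    and i: "i < k" "x i \<le> 0" and j: "j < k" "0 \<le> x j"
  shows "\<bar>\<Sum>i<k. w i * x i\<bar> \<le> (1 - \<delta>) * M"
proof -
  have le: "(\<Sum>i<k. w i * y i) \<le> (1 - \<delta>) * M"
    if y: "\<And>i. i < k \<Longrightarrow> y i \<le> M" and l: "l < k" "y l \<le> 0" and M: "0 \<le> M" for y l
  proof -
    have "(\<Sum>i<k. w i * y i) = w l * y l + (\<Sum>i\<in>{..<k} - {l}. w i * y i)"
      using l by (simp add: sum.remove)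
    also have "\<dots> \<le> 0 + (\<Sum>i\<in>{..<k} - {l}. w i * M)"
    proof (intro add_mono sum_mono mult_left_mono)
      show "w l * y l \<le> 0"
        using w[OF l(1)] \<open>0 < \<delta>\<close> l by (simp add: mult_le_0_iff)
    next
      fix i assume "i \<in> {..<k} - {l}"
      then show "y i \<le> M" "0 \<le> w i" using y w[of i] \<open>0 < \<delta>\<close> by auto
    qed
    also have "\<dots> = (1 - w l) * M"
      using l w1 by (simp add: sum_diff1 flip: sum_distrib_right)
    also have "\<dots> \<le> (1 - \<delta>) * M"
      using w[OF l(1)] M by (intro mult_right_mono) auto
    finally show ?thesis .
  qed
  have M: "0 \<le> M" using x[OF i(1)] by linarith
  have "(\<Sum>i<k. w i * x i) \<le> (1 - \<delta>) * M"
    using x i M by (intro le[of _ i]) (auto simp: abs_le_iff)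
  moreover have "(\<Sum>i<k. w i * - x i) \<le> (1 - \<delta>) * M"
    using x j M by (intro le[of "\<lambda>i. - x i" j]) (auto simp: abs_le_iff)
  ultimately show ?thesis by (simp add: sum_negf abs_le_iff)
qed

lemma tendsto_0_if_window_contraction:
  fixes x :: "nat \<Rightarrow> real"
  assumes "0 < k" and c: "0 \<le> c" "c < 1"
    and step: "\<And>n M. (\<And>i. i < k \<Longrightarrow> \<bar>x (n + i)\<bar> \<le> M) \<Longrightarrow> \<bar>x (n + k)\<bar> \<le> c * M"
  shows "x \<longlonglongrightarrow> 0"
proof -
  define B where "B = (\<Sum>i<k. \<bar>x i\<bar>)"
  have "0 \<le> B" by (simp add: B_def sum_nonneg)
  have bound: "\<bar>x n\<bar> \<le> B * c ^ (n div k)" for n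
  proof (induction n rule: less_induct)
    case (less n)
    show ?case
    proof (cases "n < k")
      case True
      then have "\<bar>x n\<bar> \<le> B"
        unfolding B_def by (intro member_le_sum) auto
      with True show ?thesis by simp
    next
      case False
      define m where "m = n - k"
      have n: "n = m + k" using False by (simp add: m_def)
      have "\<bar>x (m + k)\<bar> \<le> c * (B * c ^ (m div k))"
      proof (rule step)
        fix i assume "i < k"
        then have "\<bar>x (m + i)\<bar> \<le> B * c ^ ((m + i) div k)" by (intro less) (simp add: n)
        also have "\<dots> \<le> B * c ^ (m div k)"
          using c \<open>0 \<le> B\<close> by (intro mult_left_mono power_decreasing div_le_mono) auto
        finally show "\<bar>x (m + i)\<bar> \<le> B * c ^ (m div k)" .
      qed
      then show ?thesis using \<open>0 < k\<close> by (simp add: n mult_ac)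
    qed
  qed
  have "filterlim (\<lambda>n. n div k) sequentially sequentially"
    using \<open>0 < k\<close> by (rule filterlim_at_top_div_const_nat)
  then have "(\<lambda>n. c ^ (n div k)) \<longlonglongrightarrow> 0"
    using c by (intro filterlim_compose[OF LIMSEQ_realpow_zero]) auto
  then show ?thesis
    by (rule tendsto_0_le[where K = B]) (use bound c in \<open>simp add: mult.commute\<close>)
qed

lemma nonpos_if_iterated_difference_nonpos:
  fixes A :: "nat \<Rightarrow> nat \<Rightarrow> real"
  assumes diff: "\<And>p i. A p i - A p (Suc i) = A (Suc p) i"
    and lim: "\<And>p. A p \<longlonglongrightarrow> 0"
    and "\<And>i. A m i \<le> 0"
  shows "A 0 i \<le> 0"
  using assms(3)
proof (induction m arbitrary: i)
  case 0
  then show ?case by simp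
next
  case (Suc m)
  have "incseq (A m)"
    using Suc.prems diff[of m] by (intro incseq_SucI) (smt (verit))
  then show ?case
    using lim incseq_le by (intro Suc.IH) blast
qed

text \<open>The traces of \<open>r\<^sup>n\<close>, with initial values given by Newton's identities for
  \<open>x\<^sup>k - x\<^sup>k\<^sup>-\<^sup>1 - \<dots> - 1\<close>.\<close>

function kbonacci_lucas :: "nat \<Rightarrow> nat \<Rightarrow> int" where
  "kbonacci_lucas k n =
     (if n = 0 then int k else if n \<le> k then 2 ^ n - 1
      else 2 * kbonacci_lucas k (n - 1) - kbonacci_lucas k (n - Suc k))"
  by pat_completeness auto
termination by (relation "measure snd") auto

declare kbonacci_lucas.simps [simp del]

lemma kbonacci_lucas_rec:
  "kbonacci_lucas k (Suc (n + k)) = 2 * kbonacci_lucas k (n + k) - kbonacci_lucas k n"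
  by (subst kbonacci_lucas.simps) simp

section \<open>The k-bonacci root and its trace errors\<close>

text \<open>The equation \<open>root\<close> is \<open>r - 1\<close> times the k-bonacci equation
  for \<open>r\<close>; the condition \<open>1 < r\<close> excludes the spurious root 1.\<close>

locale kbonacci_root =
  fixes k :: nat and r :: real
  assumes r: "1 < r" "r < 2" and root: "(2 - r) * r ^ k = 1"
begin

definition err :: "nat \<Rightarrow> real" where
  "err n = of_int (kbonacci_lucas k n) - r ^ n"

lemma k_pos: "0 < k"
  using r root by (cases k) auto

lemma err_rec: "err (n + k + 1) = 2 * err (n + k) - err n"
proof -
  have "r ^ (n + k + 1) = 2 * r ^ (n + k) - (2 - r) * r ^ k * r ^ n"
    by (simp add: power_add algebra_simps)
  then show ?thesis by (simp add: err_def kbonacci_lucas_rec root)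
qed

lemma err_init: "i \<le> k \<Longrightarrow> err i = 2 ^ i - 1 - r ^ i + (if i = 0 then real k else 0)"
  by (subst err_def, subst kbonacci_lucas.simps) auto

lemma sum_pow_r: "(\<Sum>i<k. r ^ i) = r ^ k"
proof -
  have "(r - 1) * (\<Sum>i<k. r ^ i) = r ^ k - 1"
    using r by (simp add: geometric_sum)
  also have "\<dots> = (r - 1) * r ^ k" using root by (simp add: algebra_simps)
  finally show ?thesis using r by simp
qed

lemma sum_weights: "(\<Sum>i<k. 1 / r ^ Suc i) = 1"
proof -
  have "(\<Sum>i<k. 1 / r ^ Suc i) = (\<Sum>i<k. r ^ i) / r ^ k"
    unfolding sum_divide_distrib
    by (rule sum.reindex_bij_witness[of _ "\<lambda>i. k - Suc i" "\<lambda>i. k - Suc i"])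
       (use r in \<open>auto simp: field_simps simp flip: power_add power_Suc\<close>)
  then show ?thesis using r by (simp add: sum_pow_r)
qed

text \<open>By \<open>err_rec\<close> the difference of the two sides does not depend on
  \<open>n\<close>, so the initial values decide.\<close>

lemma err_eq_sum: "err (n + k) = (\<Sum>i<k. err (n + i))"
proof (induction n)
  case 0
  have "(\<Sum>i<k. err i) = (\<Sum>i<k. 2 ^ i - 1 - r ^ i + (if i = 0 then real k else 0))"
    by (intro sum.cong) (auto simp: err_init)
  also have "\<dots> = (2 ^ k - 1) - real k - r ^ k + real k"
    using k_pos by (simp add: sum.distrib sum_subtractf sum_pow_r geometric_sum)
  finally show ?case using k_pos by (simp add: err_init)
next
  case (Suc n)
  have "(\<Sum>i<k. err (Suc n + i)) = (\<Sum>i<Suc k. err (n + i)) - err n"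
    by (simp add: sum.lessThan_Suc_shift del: sum.lessThan_Suc)
  also have "\<dots> = err (Suc n + k)"
    using Suc err_rec[of n] by simp
  finally show ?case by simp
qed

text \<open>Its characteristic polynomial is \<open>(x^(k+1) - 2 x^k + 1) / (x - r)\<close>: the
  errors have no component along \<open>r^n\<close>. The weights are positive with sum 1, which
  makes this an average.\<close>

lemma err_eq_weighted_sum: "err (n + k) = (\<Sum>i<k. 1 / r ^ Suc i * err (n + i))"
proof (induction n)
  case 0
  have "(\<Sum>i<k. 1 / r ^ Suc i * err i) =
        (\<Sum>i<k. 1 / r * (2 / r) ^ i - 1 / r ^ Suc i - 1 / r + (if i = 0 then real k / r else 0))"
    using r by (intro sum.cong) (auto simp: err_init field_simps)
  \<comment> \<open>The initial trace \<open>k\<close> cancels the \<open>k\<close> summands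
    \<open>1 / r\<close>.\<close>
  also have "\<dots> = 1 / r * (\<Sum>i<k. (2 / r) ^ i) - 1"
    using k_pos by (simp add: sum.distrib sum_subtractf sum_weights sum_distrib_left del: power_Suc)
  also have "1 / r * (\<Sum>i<k. (2 / r) ^ i) = 2 ^ k - r ^ k"
  proof -
    have "(2 - r) * (1 / r * (\<Sum>i<k. (2 / r) ^ i)) = (2 / r - 1) * (\<Sum>i<k. (2 / r) ^ i)"
      using r by (simp add: diff_divide_distrib left_diff_distrib)
    also have "\<dots> = (2 / r) ^ k - 1" using r by (simp add: geometric_sum)
    also have "\<dots> = (2 - r) * r ^ k * ((2 / r) ^ k - 1)"
      by (simp add: root)
    also have "\<dots> = (2 - r) * (r ^ k * (2 / r) ^ k - r ^ k)"
      by (simp add: algebra_simps)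
    also have "r ^ k * (2 / r) ^ k = 2 ^ k" using r by (simp add: power_divide)
    finally show ?thesis unfolding mult_cancel_left using r by simp
  qed
  finally show ?case using k_pos by (simp add: err_init)
next
  case (Suc n)
  have "(\<Sum>i<k. 1 / r ^ Suc i * err (Suc n + i))
      = r * ((\<Sum>i<Suc k. 1 / r ^ Suc i * err (n + i)) - err n / r)"
    using r by (simp add: sum.lessThan_Suc_shift sum_distrib_left field_simps del: sum.lessThan_Suc)
  also have "\<dots> = r * err (n + k) + 1 / r ^ k * err (n + k) - err n"
    using r Suc by (simp add: field_simps)
  also have "1 / r ^ k = 2 - r" using root r by (simp add: field_simps)
  also have "r * err (n + k) + (2 - r) * err (n + k) - err n = err (Suc n + k)"
    using err_rec[of n] by (simp add: algebra_simps)
  finally show ?case by simp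
qed

text \<open>Subtracting the two expressions for \<open>err (n + k)\<close> gives a vanishing combination of the
  window with positive coefficients.\<close>

lemma window_sign_change:
  obtains i j where "i < k" "err (n + i) \<le> 0" "j < k" "0 \<le> err (n + j)"
proof -
  have eq: "(\<Sum>i<k. (1 - 1 / r ^ Suc i) * err (n + i)) = 0"
    using err_eq_sum[of n] err_eq_weighted_sum[of n]
    by (simp add: left_diff_distrib sum_subtractf)
  have pos: "0 < 1 - 1 / r ^ Suc i" for i
    using r one_less_power[of r "Suc i"] by simp
  have ne: "{..<k} \<noteq> {}" using k_pos by auto
  have "\<exists>i<k. err (n + i) \<le> 0"
  proof (rule ccontr)
    assume "\<not> ?thesis"
    then have "0 < (\<Sum>i<k. (1 - 1 / r ^ Suc i) * err (n + i))"
      using ne pos by (intro sum_pos mult_pos_pos) (auto simp: not_le)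
    then show False using eq by simp
  qed
  moreover have "\<exists>i<k. 0 \<le> err (n + i)"
  proof (rule ccontr)
    assume "\<not> ?thesis"
    then have "0 < (\<Sum>i<k. (1 - 1 / r ^ Suc i) * - err (n + i))"
      using ne pos by (intro sum_pos mult_pos_pos) (auto simp: not_le)
    then show False using eq by (simp add: sum_negf)
  qed
  ultimately show ?thesis using that by blast
qed

text \<open>Each window contains both signs, so averaging over it gains at least the smallest
  weight, \<open>1 / r ^ k\<close>.\<close>

lemma err_tendsto_0: "err \<longlonglongrightarrow> 0"
proof (rule tendsto_0_if_window_contraction)
  show "0 < k" by (rule k_pos)
  show "0 \<le> 1 - 1 / r ^ k" "1 - 1 / r ^ k < 1" using r by auto
next
  fix n M assume M: "\<And>i. i < k \<Longrightarrow> \<bar>err (n + i)\<bar> \<le> M"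
  obtain i j where "i < k" "err (n + i) \<le> 0" "j < k" "0 \<le> err (n + j)"
    by (rule window_sign_change)
  moreover have "1 / r ^ k \<le> 1 / r ^ Suc i" if "i < k" for i
    using r that by (intro divide_left_mono power_increasing) auto
  ultimately show "\<bar>err (n + k)\<bar> \<le> (1 - 1 / r ^ k) * M"
    unfolding err_eq_weighted_sum using M r sum_weights
    by (intro abs_weighted_sum_le[of k _ _ _ _ i j]) auto
qed

text \<open>A zero error counts as negative here, since an integral power is its own floor.\<close>

lemma floor_power:
  assumes "\<bar>err n\<bar> < 1"
  shows "\<lfloor>r ^ n\<rfloor> = kbonacci_lucas k n - (if 0 < err n then 1 else 0)"
  using assms by (auto simp: err_def floor_eq_iff)

lemma err_signs_alternate_imp_False:
  assumes "odd k"
    and alt: "\<And>n. N \<le> n \<Longrightarrow> 0 < err (n + k + 1) \<longleftrightarrow> \<not> 0 < err n"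
  shows False
proof -
  define s :: real where "s = (if 0 < err N then 1 else - 1)"
  \<comment> \<open>This is \<open>(1 - U)\<close> applied \<open>p\<close> times to
    \<open>A 0\<close>, in the closed form given by \<open>2 S^k = 1 - U\<close>.\<close>
  define A where "A p i = s * (- 1) ^ i * 2 ^ p * err (N + i * (k + 1) + k * p)" for p i
  have sgn: "0 < err (N + i * (k + 1)) \<longleftrightarrow> s * (- 1) ^ i = 1" for i
  proof (induction i)
    case 0
    then show ?case by (simp add: s_def)
  next
    case (Suc i)
    have "s * (- 1) ^ i = 1 \<or> s * (- 1) ^ i = - 1"
      by (cases "even i") (auto simp: s_def)
    then show ?case
      using Suc alt[of "N + i * (k + 1)"] by (auto simp: algebra_simps)
  qed
  have A0: "0 \<le> A 0 i" for i
    using sgn[of i] by (cases "even i") (auto simp: A_def s_def split: if_splits)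
  have A0_le: "A 0 i \<le> 0" for i
  proof (rule nonpos_if_iterated_difference_nonpos[where A = A and m = "k + 1"])
    fix p i
    have "A p i - A p (Suc i) = s * (- 1) ^ i * 2 ^ p *
        (err (N + i * (k + 1) + k * p) + err (N + i * (k + 1) + k * p + k + 1))"
      by (simp add: A_def algebra_simps)
    also have "\<dots> = A (Suc p) i"
      by (subst err_rec) (simp add: A_def algebra_simps)
    finally show "A p i - A p (Suc i) = A (Suc p) i" .
  next
    fix p
    have "filterlim (\<lambda>i. N + i * (k + 1) + k * p) sequentially sequentially"
      by (rule filterlim_at_top_mono[OF filterlim_ident]) (auto intro!: always_eventually)
    then have "(\<lambda>i. err (N + i * (k + 1) + k * p)) \<longlonglongrightarrow> 0"
      by (rule filterlim_compose[OF err_tendsto_0])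
    then have "(\<lambda>i. \<bar>2 ^ p * err (N + i * (k + 1) + k * p)\<bar>) \<longlonglongrightarrow> 0"
      by (intro tendsto_rabs_zero tendsto_mult_right_zero)
    then have "(\<lambda>i. \<bar>A p i\<bar>) \<longlonglongrightarrow> 0"
      by (simp add: A_def s_def abs_mult power_abs)
    then show "A p \<longlonglongrightarrow> 0" by (rule tendsto_rabs_zero_cancel)
  next
    fix i
    \<comment> \<open>The offset \<open>k * (k + 1)\<close> amounts to \<open>k\<close> steps of
      \<open>i\<close>, and the sign \<open>(- 1) ^ k\<close> is -1 for odd
      \<open>k\<close>.\<close>
    have "A (k + 1) i = - (2 ^ (k + 1) * A 0 (i + k))"
      using \<open>odd k\<close> by (simp add: A_def power_add algebra_simps)
    then show "A (k + 1) i \<le> 0" using A0[of "i + k"] by simp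
  qed
  have "err (N + i * (k + 1)) = 0" for i
    using A0[of i] A0_le[of i] by (cases "even i") (auto simp: A_def s_def split: if_splits)
  from this[of 0] this[of 1] show False using alt[of N] by simp
qed

lemma not_tail_sidon:
  assumes "odd k"
  shows "\<not> tail_sidon r"
proof
  assume "tail_sidon r"
  then obtain N0 where sidon: "sidon (S_tail r N0)" by (auto simp: tail_sidon_def)
  have "\<forall>\<^sub>F n in sequentially. \<bar>err n\<bar> < 1"
    using tendsto_rabs_zero[OF err_tendsto_0] by (rule order_tendstoD) simp
  \<comment> \<open>This makes consecutive powers differ by more than 1, so that their floors are
    distinct.\<close>
  moreover have "\<forall>\<^sub>F n in sequentially. 1 / (r - 1) < r ^ n"
  proof -
    obtain m where "1 / (r - 1) < r ^ m" using real_arch_pow r by blast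
    then have "1 / (r - 1) < r ^ n" if "m \<le> n" for n
      using power_increasing[OF that, of r] r by linarith
    then show ?thesis by (auto simp: eventually_sequentially)
  qed
  ultimately have "\<forall>\<^sub>F n in sequentially. \<bar>err n\<bar> < 1 \<and> 1 / (r - 1) < r ^ n \<and> N0 < n"
    using eventually_gt_at_top by (intro eventually_conj)
  then obtain N where N: "\<And>n. N \<le> n \<Longrightarrow> \<bar>err n\<bar> < 1 \<and> 1 / (r - 1) < r ^ n \<and> N0 < n"
    by (auto simp: eventually_sequentially)
  show False
  proof (rule err_signs_alternate_imp_False[OF \<open>odd k\<close>])
    fix n assume "N \<le> n"
    define F where "F m = nat \<lfloor>r ^ m\<rfloor>" for m
    have F: "int (F m) = \<lfloor>r ^ m\<rfloor>" for m using r by (simp add: F_def)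
    have "F m \<in> S_tail r N0" if "N \<le> m" for m
      using N[OF that] by (auto simp: S_tail_def F_def intro!: exI[of _ m])
    then have "{F (n + k + 1), F n} = {F (n + k)}"
      if "F (n + k + 1) + F n = F (n + k) + F (n + k)"
      using sidon that \<open>N \<le> n\<close> unfolding sidon_def
      by (metis insert_absorb2 trans_le_add1 add.assoc)
    moreover have "F (n + k) < F (n + k + 1)"
    proof -
      have "1 < (r - 1) * r ^ (n + k)"
        using N[of "n + k"] \<open>N \<le> n\<close> r by (simp add: field_simps)
      then have "r ^ (n + k) + 1 \<le> r ^ (n + k + 1)" by (simp add: algebra_simps)
      then have "\<lfloor>r ^ (n + k)\<rfloor> < \<lfloor>r ^ (n + k + 1)\<rfloor>" by linarith
      then show ?thesis using F by (metis of_nat_less_iff)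
    qed
    ultimately have "F (n + k + 1) + F n \<noteq> F (n + k) + F (n + k)" by auto
    then have "\<lfloor>r ^ (n + k + 1)\<rfloor> + \<lfloor>r ^ n\<rfloor> \<noteq> 2 * \<lfloor>r ^ (n + k)\<rfloor>"
      unfolding F[symmetric] by linarith
    \<comment> \<open>If both errors were positive, or neither, \<open>err_rec\<close> would put
      \<open>err (n + k)\<close> in the same case, and the floors would inherit the recurrence of
      the traces.\<close>
    then show "0 < err (n + k + 1) \<longleftrightarrow> \<not> 0 < err n"
      using N[of n] N[of "n + k"] N[of "n + k + 1"] \<open>N \<le> n\<close> err_rec[of n]
      by (auto simp: floor_power kbonacci_lucas_rec simp del: power_Suc split: if_splits)
  qed
qed

end

theorem theorem4p1:
  fixes \<epsilon> :: real
  assumes "\<epsilon> > 0"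
  shows "\<exists>r::real. 1 < r \<and> r \<in> {2 - \<epsilon><..<2} \<and> \<not> tail_sidon r"
proof -
  define \<delta> where "\<delta> = min (\<epsilon> / 2) (1 / 2)"
  have \<delta>: "0 < \<delta>" "\<delta> < \<epsilon>" "\<delta> < 1" using assms by (auto simp: \<delta>_def)
  \<comment> \<open>With this \<open>m\<close>, \<open>(2 - r) * r ^ k\<close> is at least 1 at
    \<open>2 - \<delta>\<close> and 0 at 2; \<open>k = 2 * m + 1\<close> makes the exponent
    odd.\<close>
  obtain m where m: "1 / \<delta> < (2 - \<delta>) ^ m"
    using real_arch_pow[of "2 - \<delta>"] \<delta> by auto
  define k where "k = 2 * m + 1"
  have "1 / \<delta> < (2 - \<delta>) ^ k"
    using m power_increasing[of m k "2 - \<delta>"] \<delta> by (simp add: k_def)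
  then have "1 \<le> (2 - (2 - \<delta>)) * (2 - \<delta>) ^ k" using \<delta> by (simp add: field_simps)
  moreover have "continuous_on {2 - \<delta>..2} (\<lambda>r. (2 - r) * r ^ k)"
    by (intro continuous_intros)
  ultimately obtain r where r_eq: "2 - \<delta> \<le> r" "r \<le> 2" "(2 - r) * r ^ k = 1"
    using IVT2'[of "\<lambda>r. (2 - r) * r ^ k" 2 1 "2 - \<delta>"] \<delta> by auto
  then have "r \<noteq> 2" by auto
  then interpret kbonacci_root k r
    using r_eq \<delta> by unfold_locales auto
  show ?thesis
    using r_eq(1,2) \<open>r \<noteq> 2\<close> \<delta> not_tail_sidon by (intro exI[of _ r]) (simp add: k_def)
qed

end
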